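(* Let $\mathbf R=(R,\leq,\odot,\rightarrow,0,1)$ be a divisible operator residuated structure of finite height satisfying both the double negation law and the contraposition law, and define $x':=x\rightarrow 0$ for all $x\in R$. Then $\mathbb P(\mathbf R):=(R,\leq,{}',0,1)$ is an orthomodular poset.
   Context: Orthomodular poset: a bounded poset $(P,\leq,{}',0,1)$ with a unary operation $'$ that is an antitone involution ($x\le y$ implies $y'\le x'$; $x''=x$) and a complementation ($x\vee x'=1$ and $x\wedge x'=0$ for all $x$), such that: if $x\leq y'$ then the join $x\vee y$ exists; and if $x\leq y$ then $y=x\vee(y'\vee x)'$. A poset is of finite height if it contains no infinite chain. Set notation in a poset $(P,\le)$: for $A,B\subseteq P$, $A\leq B$ means $x\leq y$ for all $x\in A$, $y\in B$; $L(x,y)=\{z\in P\mid z\leq x\text{ and }z\leq y\}$; $\operatorname{Max}A$ is the set of maximal elements of $A$. Lattice operations on sets are elementwise: $A\wedge y=\{a\wedge y\mid a\in A\}$, $A\vee y=\{a\vee y\mid a\in A\}$. Elements $x$ are identified with singletons $\{x\}$. For non-empty $A,B\subseteq P$: $A\sqsubseteq B$ iff there are $a\in A$ and $b\in B$ with $a\leq b$. For a mapping $\otimes\colon P^2\to 2^P$, $A\subseteq P$ and $y\in P$ put $A\otimes y:=\bigcup_{x\in A}(x\otimes y)$. An operator residuated structure is a six-tuple $(P,\leq,\odot,\rightarrow,0,1)$ such that for all $x,y,z\in P$: (i) $(P,\leq,0,1)$ is a bounded poset; (ii) $\odot$ and $\rightarrow$ are mappings from $P^2$ to $2^P\setminus\{\emptyset\}$;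 (iii) $x\odot y\sqsubseteq z$ if and only if $x\sqsubseteq y\rightarrow z$; (iv) $x\odot 1=1\odot x=x$; (v) $y\rightarrow 0\leq x$ implies $x\odot y=x\wedge y$ (in particular the meet exists); (vi) $y\leq x$ implies $x\rightarrow y=(x\rightarrow 0)\vee y$ (in particular the joins exist). It is of finite height if $(P,\le)$ is. It is divisible if $(x\rightarrow y)\odot x=\operatorname{Max}L(x,y)$ for all $x,y$; it satisfies the double negation law if $(x\rightarrow 0)\rightarrow 0=x$ for all $x$; it satisfies the contraposition law if $x\leq y$ implies $y\rightarrow 0\leq x\rightarrow 0$. Under the double negation law each set $x\rightarrow 0$ is a singleton, and $x'$ denotes its unique element. *)

theory Defs
  imports "HOL-Algebra.Lattice"
begin

locale bounded_poset = partial_order L for L (structure) +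
  fixes zero :: 'a (\<open>\<zero>\<close>) and one :: 'a (\<open>\<one>\<close>)
  assumes zero_least: "least L \<zero> (carrier L)"
    and one_greatest: "greatest L \<one> (carrier L)"

text \<open>
  \<^term>\<open>join L x y\<close> and \<^term>\<open>meet L x y\<close> are choice terms, meaningful only if a least upper
  (greatest lower) bound exists.  Existence is therefore stated separately wherever it does not
  already follow.
\<close>

locale orthomodular_poset = bounded_poset L zero one
  for L (structure) and compl :: "'a \<Rightarrow> 'a" and zero (\<open>\<zero>\<close>) and one (\<open>\<one>\<close>) +
  assumes compl_closed: "x \<in> carrier L \<Longrightarrow> compl x \<in> carrier L"
    and compl_antitone:
      "\<lbrakk>x \<in> carrier L; y \<in> carrier L; x \<sqsubseteq> y\<rbrakk> \<Longrightarrow> compl y \<sqsubseteq> compl x"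
    and compl_involution: "x \<in> carrier L \<Longrightarrow> compl (compl x) = x"
    and compl_join: "x \<in> carrier L \<Longrightarrow> is_lub L \<one> {x, compl x}"
    and compl_meet: "x \<in> carrier L \<Longrightarrow> is_glb L \<zero> {x, compl x}"
    and orthogonal_join_exists:
      "\<lbrakk>x \<in> carrier L; y \<in> carrier L; x \<sqsubseteq> compl y\<rbrakk> \<Longrightarrow> \<exists>s. is_lub L s {x, y}"
    \<comment> \<open>Both joins below exist by the previous axiom: \<open>y' \<le> x'\<close> and \<open>x \<le> (y' \<squnion> x)''\<close>.\<close>
    and orthomodular_law:
      "\<lbrakk>x \<in> carrier L; y \<in> carrier L; x \<sqsubseteq> y\<rbrakk>
        \<Longrightarrow> y = x \<squnion> compl (compl y \<squnion> x)"

definition finite_height :: "('a, 'b) gorder_scheme \<Rightarrow> bool" where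
  "finite_height L \<longleftrightarrow>
    (\<forall>C. C \<subseteq> carrier L \<and> Complete_Partial_Order.chain (le L) C \<longrightarrow> finite C)"

definition maximal_elements :: "('a, 'b) gorder_scheme \<Rightarrow> 'a set \<Rightarrow> 'a set" where
  "maximal_elements L A = {x \<in> A. \<forall>y\<in>A. x \<sqsubseteq>\<^bsub>L\<^esub> y \<longrightarrow> y = x}"

text \<open>The relations \<open>A \<le> B\<close> and \<open>A \<sqsubseteq> B\<close> between subsets, respectively.\<close>

definition set_le :: "('a, 'b) gorder_scheme \<Rightarrow> 'a set \<Rightarrow> 'a set \<Rightarrow> bool" where
  "set_le L A B \<longleftrightarrow> (\<forall>a\<in>A. \<forall>b\<in>B. a \<sqsubseteq>\<^bsub>L\<^esub> b)"

definition some_le :: "('a, 'b) gorder_scheme \<Rightarrow> 'a set \<Rightarrow> 'a set \<Rightarrow> bool" where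
  "some_le L A B \<longleftrightarrow> (\<exists>a\<in>A. \<exists>b\<in>B. a \<sqsubseteq>\<^bsub>L\<^esub> b)"

definition set_op :: "('a \<Rightarrow> 'a \<Rightarrow> 'a set) \<Rightarrow> 'a set \<Rightarrow> 'a \<Rightarrow> 'a set" where
  "set_op f A y = (\<Union>x\<in>A. f x y)"

locale operator_residuated_structure = bounded_poset L zero one
  for L (structure) and odot :: "'a \<Rightarrow> 'a \<Rightarrow> 'a set" (infixl \<open>\<odot>\<close> 70)
    and imp :: "'a \<Rightarrow> 'a \<Rightarrow> 'a set" (infixr \<open>\<rightarrow>\<close> 60)
    and zero (\<open>\<zero>\<close>) and one (\<open>\<one>\<close>) +
  assumes odot_closed:
      "\<lbrakk>x \<in> carrier L; y \<in> carrier L\<rbrakk> \<Longrightarrow> x \<odot> y \<subseteq> carrier L \<and> x \<odot> y \<noteq> {}"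
    and imp_closed:
      "\<lbrakk>x \<in> carrier L; y \<in> carrier L\<rbrakk> \<Longrightarrow> (x \<rightarrow> y) \<subseteq> carrier L \<and> (x \<rightarrow> y) \<noteq> {}"
    and adjointness:
      "\<lbrakk>x \<in> carrier L; y \<in> carrier L; z \<in> carrier L\<rbrakk>
        \<Longrightarrow> some_le L (x \<odot> y) {z} \<longleftrightarrow> some_le L {x} (y \<rightarrow> z)"
    and odot_one: "x \<in> carrier L \<Longrightarrow> x \<odot> \<one> = {x}"
    and one_odot: "x \<in> carrier L \<Longrightarrow> \<one> \<odot> x = {x}"
    and odot_eq_meet:
      "\<lbrakk>x \<in> carrier L; y \<in> carrier L; set_le L (y \<rightarrow> \<zero>) {x}\<rbrakk>
        \<Longrightarrow> (\<exists>m. is_glb L m {x, y}) \<and> x \<odot> y = {x \<sqinter> y}"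
    and imp_eq_join:
      "\<lbrakk>x \<in> carrier L; y \<in> carrier L; y \<sqsubseteq> x\<rbrakk>
        \<Longrightarrow> (\<forall>a \<in> x \<rightarrow> \<zero>. \<exists>s. is_lub L s {a, y})
          \<and> (x \<rightarrow> y) = (\<lambda>a. a \<squnion> y) ` (x \<rightarrow> \<zero>)"

definition divisible ::
  "('a, 'b) gorder_scheme \<Rightarrow> ('a \<Rightarrow> 'a \<Rightarrow> 'a set) \<Rightarrow> ('a \<Rightarrow> 'a \<Rightarrow> 'a set) \<Rightarrow> bool" where
  "divisible L odot imp \<longleftrightarrow>
    (\<forall>x\<in>carrier L. \<forall>y\<in>carrier L.
      set_op odot (imp x y) x = maximal_elements L (Lower L {x, y}))"

definition double_negation_law ::
  "('a, 'b) gorder_scheme \<Rightarrow> ('a \<Rightarrow> 'a \<Rightarrow> 'a set) \<Rightarrow> 'a \<Rightarrow> bool" where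
  "double_negation_law L imp zero \<longleftrightarrow>
    (\<forall>x\<in>carrier L. set_op imp (imp x zero) zero = {x})"

definition contraposition_law ::
  "('a, 'b) gorder_scheme \<Rightarrow> ('a \<Rightarrow> 'a \<Rightarrow> 'a set) \<Rightarrow> 'a \<Rightarrow> bool" where
  "contraposition_law L imp zero \<longleftrightarrow>
    (\<forall>x\<in>carrier L. \<forall>y\<in>carrier L.
      x \<sqsubseteq>\<^bsub>L\<^esub> y \<longrightarrow> set_le L (imp y zero) (imp x zero))"

definition negation :: "('a \<Rightarrow> 'a \<Rightarrow> 'a set) \<Rightarrow> 'a \<Rightarrow> 'a \<Rightarrow> 'a" where
  "negation imp zero x = the_elem (imp x zero)"

text \<open>
  Under the double negation law, \<^const>\<open>negation\<close> is well defined on the carrier.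
\<close>

lemma (in operator_residuated_structure) imp_zero_eq_negation:
  assumes dn: "double_negation_law L imp zero" and x: "x \<in> carrier L"
  shows "(x \<rightarrow> \<zero>) = {negation imp \<zero> x}"
proof -
  have z: "\<zero> \<in> carrier L"
    using zero_least by (simp add: least_def)
  have dn': "(\<Union>b\<in>y \<rightarrow> \<zero>. b \<rightarrow> \<zero>) = {y}" if "y \<in> carrier L" for y
    using dn that by (simp add: double_negation_law_def set_op_def)
  obtain a where a: "a \<in> x \<rightarrow> \<zero>"
    using imp_closed[OF x z] by blast
  then have ac: "a \<in> carrier L"
    using imp_closed[OF x z] by blast
  have "(a \<rightarrow> \<zero>) \<subseteq> {x}"
    using dn'[OF x] a by blast
  then have "(a \<rightarrow> \<zero>) = {x}"
    using imp_closed[OF ac z] by blast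
  then have "(x \<rightarrow> \<zero>) = {a}"
    using dn'[OF ac] by simp
  then show ?thesis
    by (simp add: negation_def)
qed

end

theory Submission
  imports Defs
begin

text \<open>
  The negation is an antitone involution, so it exchanges meets and joins.  For \<open>x \<le> y\<close>,
  divisibility evaluates \<open>(y \<rightarrow> x) \<odot> y\<close> to \<open>x\<close>, while \<open>y \<rightarrow> x = y' \<squnion> x \<ge> y'\<close> turns the
  product into a meet; hence \<open>(y' \<squnion> x) \<sqinter> y = x\<close>.  Taking \<open>x = 0\<close> gives complementation, and
  negating the instance \<open>y' \<le> x'\<close> gives the orthomodular law.
\<close>

lemma (in partial_order) is_lub_join:
  assumes "is_lub L s {x, y}"
  shows "x \<squnion> y = s"
  unfolding join_def sup_def using assms by (blast intro: someI2 least_unique)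

lemma (in partial_order) is_glb_meet:
  assumes "is_glb L m {x, y}"
  shows "x \<sqinter> y = m"
  unfolding meet_def inf_def using assms by (blast intro: someI2 greatest_unique)

lemma (in partial_order) is_lub_pair_iff:
  assumes "x \<in> carrier L" "y \<in> carrier L"
  shows "is_lub L s {x, y} \<longleftrightarrow> s \<in> carrier L \<and> x \<sqsubseteq> s \<and> y \<sqsubseteq> s
    \<and> (\<forall>z\<in>carrier L. x \<sqsubseteq> z \<and> y \<sqsubseteq> z \<longrightarrow> s \<sqsubseteq> z)"
  using assms unfolding least_def Upper_def by auto

lemma (in partial_order) is_glb_pair_iff:
  assumes "x \<in> carrier L" "y \<in> carrier L"
  shows "is_glb L m {x, y} \<longleftrightarrow> m \<in> carrier L \<and> m \<sqsubseteq> x \<and> m \<sqsubseteq> y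
    \<and> (\<forall>z\<in>carrier L. z \<sqsubseteq> x \<and> z \<sqsubseteq> y \<longrightarrow> z \<sqsubseteq> m)"
  using assms unfolding greatest_def Lower_def by auto

text \<open>If \<open>z\<close> bounds \<open>n x\<close> and \<open>n y\<close> from above, then
  \<open>n z\<close> bounds \<open>x\<close> and \<open>y\<close> from below and so lies below
  \<open>m\<close>; applying \<open>n\<close> once more puts \<open>n m\<close> below
  \<open>z\<close>.\<close>

lemma (in partial_order) antitone_involution_glb_lub:
  assumes closed: "\<And>u. u \<in> carrier L \<Longrightarrow> n u \<in> carrier L"
    and antitone: "\<And>u v. \<lbrakk>u \<in> carrier L; v \<in> carrier L; u \<sqsubseteq> v\<rbrakk> \<Longrightarrow> n v \<sqsubseteq> n u"
    and involution: "\<And>u. u \<in> carrier L \<Longrightarrow> n (n u) = u"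
    and x: "x \<in> carrier L" and y: "y \<in> carrier L" and glb: "is_glb L m {x, y}"
  shows "is_lub L (n m) {n x, n y}"
proof -
  have m: "m \<in> carrier L" "m \<sqsubseteq> x" "m \<sqsubseteq> y"
    and greatest: "\<And>z. \<lbrakk>z \<in> carrier L; z \<sqsubseteq> x; z \<sqsubseteq> y\<rbrakk> \<Longrightarrow> z \<sqsubseteq> m"
    using glb x y by (auto simp: is_glb_pair_iff)
  have "n m \<sqsubseteq> z" if z: "z \<in> carrier L" "n x \<sqsubseteq> z" "n y \<sqsubseteq> z" for z
  proof -
    have "n z \<sqsubseteq> x" "n z \<sqsubseteq> y"
      using antitone[of "n x" z] antitone[of "n y" z] closed involution x y z by auto
    then have "n z \<sqsubseteq> m"
      by (simp add: closed greatest z)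
    then show ?thesis
      using antitone[of "n z" m] closed involution m z by auto
  qed
  then show ?thesis
    using antitone closed m x y by (simp add: is_lub_pair_iff)
qed

text \<open>For comparable arguments the lower cone is the principal ideal of the smaller one, so
  divisibility returns that element alone.\<close>

lemma (in partial_order) maximal_elements_Lower:
  assumes "x \<in> carrier L" "y \<in> carrier L" "x \<sqsubseteq> y"
  shows "maximal_elements L (Lower L {y, x}) = {x}"
proof -
  have "Lower L {y, x} = {z \<in> carrier L. z \<sqsubseteq> x}"
    using assms by (auto simp: Lower_def intro: le_trans)
  then show ?thesis
    using assms(1) by (auto simp: maximal_elements_def intro: le_antisym)
qed

context operator_residuated_structure
begin

context
  assumes divisible: "divisible L odot imp"
    and double_negation: "double_negation_law L imp \<zero>"
    and contraposition: "contraposition_law L imp \<zero>"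
begin

abbreviation neg :: "'a \<Rightarrow> 'a" where
  "neg \<equiv> negation imp \<zero>"

lemma zero_closed: "\<zero> \<in> carrier L" and zero_le: "x \<in> carrier L \<Longrightarrow> \<zero> \<sqsubseteq> x"
  using zero_least by (auto simp: least_def)

lemma one_closed: "\<one> \<in> carrier L" and le_one: "x \<in> carrier L \<Longrightarrow> x \<sqsubseteq> \<one>"
  using one_greatest by (auto simp: greatest_def)

lemmas imp_zero = imp_zero_eq_negation[OF double_negation]

lemma neg_closed: "x \<in> carrier L \<Longrightarrow> neg x \<in> carrier L"
  using imp_closed[OF _ zero_closed] imp_zero by auto

lemma neg_antitone:
  "\<lbrakk>x \<in> carrier L; y \<in> carrier L; x \<sqsubseteq> y\<rbrakk> \<Longrightarrow> neg y \<sqsubseteq> neg x"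
  using contraposition by (auto simp: contraposition_law_def set_le_def imp_zero)

lemma neg_neg: "x \<in> carrier L \<Longrightarrow> neg (neg x) = x"
  using double_negation
  by (auto simp: double_negation_law_def set_op_def imp_zero neg_closed)

lemma neg_glb_lub:
  "\<lbrakk>x \<in> carrier L; y \<in> carrier L; is_glb L m {x, y}\<rbrakk> \<Longrightarrow> is_lub L (neg m) {neg x, neg y}"
  by (rule antitone_involution_glb_lub[of neg]) (simp_all add: neg_closed neg_antitone neg_neg)

lemma neg_zero: "neg \<zero> = \<one>"
proof (rule le_antisym)
  show "\<one> \<sqsubseteq> neg \<zero>"
    \<comment> \<open>Negating \<open>\<zero> \<sqsubseteq> neg \<one>\<close> gives
      \<open>neg (neg \<one>) \<sqsubseteq> neg \<zero>\<close>.\<close>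
    using neg_antitone[of \<zero> "neg \<one>"]
    by (simp add: neg_closed neg_neg one_closed zero_closed zero_le)
qed (simp_all add: le_one neg_closed zero_closed one_closed)

text \<open>Double negation makes \<open>y \<rightarrow> \<zero>\<close> a singleton, so
  \<open>imp_eq_join\<close> yields a single join. Its existence is recorded as well: it gives the
  choice term \<open>neg y \<squnion> x\<close> its meaning and later supplies the joins of
  orthogonal elements.\<close>

lemma imp_below:
  assumes x: "x \<in> carrier L" and y: "y \<in> carrier L" and xy: "x \<sqsubseteq> y"
  shows "is_lub L (neg y \<squnion> x) {neg y, x}" and "(y \<rightarrow> x) = {neg y \<squnion> x}"
proof -
  have "\<exists>s. is_lub L s {neg y, x}"
    using imp_eq_join[OF y x xy] by (simp add: imp_zero y)
  then show "is_lub L (neg y \<squnion> x) {neg y, x}"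
    using is_lub_join by blast
  show "(y \<rightarrow> x) = {neg y \<squnion> x}"
    using imp_eq_join[OF y x xy] by (simp add: imp_zero y)
qed

lemma glb_join_neg:
  assumes x: "x \<in> carrier L" and y: "y \<in> carrier L" and xy: "x \<sqsubseteq> y"
  shows "is_glb L x {neg y \<squnion> x, y}"
proof -
  let ?j = "neg y \<squnion> x"
  have j: "?j \<in> carrier L" "neg y \<sqsubseteq> ?j"
    using imp_below(1)[OF assms] by (simp_all add: is_lub_pair_iff neg_closed x y)
  \<comment> \<open>This is the premise under which \<open>odot_eq_meet\<close> turns
    \<open>?j \<odot> y\<close> into a meet and also guarantees that the meet exists.\<close>
  have "set_le L (y \<rightarrow> \<zero>) {?j}"
    using j(2) by (simp add: set_le_def imp_zero y)
  then obtain m where m: "is_glb L m {?j, y}" and prod: "?j \<odot> y = {?j \<sqinter> y}"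
    using odot_eq_meet[OF j(1) y] by blast
  have "set_op odot (y \<rightarrow> x) y = maximal_elements L (Lower L {y, x})"
    using divisible x y by (simp add: divisible_def)
  \<comment> \<open>As \<open>y \<rightarrow> x\<close> is the singleton of \<open>?j\<close>, the
    union in \<open>set_op\<close> collapses to this one product.\<close>
  then have "?j \<odot> y = {x}"
    by (simp add: maximal_elements_Lower[OF assms] imp_below(2)[OF assms] set_op_def)
  then show ?thesis
    using m prod is_glb_meet[OF m] by simp
qed

lemma is_orthomodular_poset: "orthomodular_poset L neg \<zero> \<one>"
proof unfold_locales
  show "y = x \<squnion> neg (neg y \<squnion> x)"
    if x: "x \<in> carrier L" and y: "y \<in> carrier L" and xy: "x \<sqsubseteq> y" for x y
  proof -
    have j: "neg y \<squnion> x \<in> carrier L"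
      using imp_below(1)[OF that] by (simp add: is_lub_pair_iff neg_closed x y)
    \<comment> \<open>This is \<open>glb_join_neg\<close> for
      \<open>neg y \<sqsubseteq> neg x\<close>, with \<open>neg (neg x)\<close> simplified to
      \<open>x\<close>.\<close>
    have "is_glb L (neg y) {x \<squnion> neg y, neg x}"
      using glb_join_neg[OF neg_closed neg_closed neg_antitone] that neg_neg by metis
    then have "is_glb L (neg y) {neg x, neg y \<squnion> x}"
      by (simp add: insert_commute join_def)
    from neg_glb_lub[OF _ _ this] have "is_lub L y {x, neg (neg y \<squnion> x)}"
      by (simp add: j neg_closed neg_neg x y)
    then show ?thesis
      using is_lub_join by metis
  qed
  show meet: "is_glb L \<zero> {x, neg x}" if x: "x \<in> carrier L" for x
  proof -
    \<comment> \<open>The join in \<open>glb_join_neg\<close> for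
      \<open>\<zero> \<sqsubseteq> x\<close> is therefore just \<open>neg x\<close>.\<close>
    have "is_lub L (neg x) {neg x, \<zero>}"
      by (simp add: is_lub_pair_iff neg_closed zero_closed zero_le x)
    then show ?thesis
      using glb_join_neg[OF zero_closed x zero_le[OF x]] is_lub_join
      by (metis insert_commute)
  qed
  \<comment> \<open>Negation swaps the two members of the pair and sends the meet
    \<open>\<zero>\<close> to \<open>\<one>\<close>.\<close>
  show "is_lub L \<one> {x, neg x}" if x: "x \<in> carrier L" for x
    using neg_glb_lub[OF x neg_closed meet] x
    by (simp add: neg_zero neg_neg insert_commute)
  show "\<exists>s. is_lub L s {x, y}"
    if x: "x \<in> carrier L" and y: "y \<in> carrier L" and xy: "x \<sqsubseteq> neg y" for x y
    \<comment> \<open>The join obtained from \<open>x \<sqsubseteq> neg y\<close> is that of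
      \<open>neg (neg y)\<close>, which is \<open>y\<close>, with \<open>x\<close>.\<close>
    using imp_below(1)[OF x neg_closed xy] neg_neg y by (metis insert_commute)
qed (simp_all add: neg_closed neg_antitone neg_neg)

end

end

theorem theorem9:
  fixes R :: "('a, 'b) gorder_scheme"
    and odot imp :: "'a \<Rightarrow> 'a \<Rightarrow> 'a set"
    and zero one :: 'a
  assumes "operator_residuated_structure R odot imp zero one"
    and "finite_height R"
    and "divisible R odot imp"
    and "double_negation_law R imp zero"
    and "contraposition_law R imp zero"
  shows "orthomodular_poset R (negation imp zero) zero one"
  using operator_residuated_structure.is_orthomodular_poset assms by metis

end
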